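(* Let $X$ be a non-negative and absolutely continuous random variable and let $Y=aX+b$, where $a>0$ and $b\ge 0$. Then, for all $t_1<t_2$ in the support $S_Y$ of $Y$ with $F_Y(t_1)<F_Y(t_2)$, $$IJ_Y^w(t_1,t_2)=IJ_X^w\!\left(\frac{t_1-b}{a},\frac{t_2-b}{a}\right)+\frac ba\, IJ_X\!\left(\frac{t_1-b}{a},\frac{t_2-b}{a}\right).$$
   Context: For a non-negative absolutely continuous random variable $Z$ with pdf $f_Z$ and cdf $F_Z$, and $0\le t_1<t_2$ with $F_Z(t_1)<F_Z(t_2)$: - the interval extropy of $Z$ is $IJ_Z(t_1,t_2)=-\frac{1}{2(F_Z(t_2)-F_Z(t_1))^2}\int_{t_1}^{t_2} f_Z^2(x)\,dx$; - the weighted interval extropy of $Z$ is $IJ_Z^w(t_1,t_2)=-\frac{1}{2(F_Z(t_2)-F_Z(t_1))^2}\int_{t_1}^{t_2} x f_Z^2(x)\,dx$. Both take values in $[-\infty,0]$, with the convention $0\cdot(-\infty)=0$. *)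

theory Defs
  imports "HOL-Probability.Probability"
begin

definition abs_continuous_rv :: "'a measure \<Rightarrow> ('a \<Rightarrow> real) \<Rightarrow> bool" where
  "abs_continuous_rv M Z \<longleftrightarrow>
     Z \<in> borel_measurable M \<and> absolutely_continuous lborel (distr M borel Z)"

text \<open>The density is only determined up to Lebesgue null sets; the Radon-Nikodym derivative
  picks one version. The extropies below do not depend on the choice, see \<open>pdf_unique\<close>.\<close>

definition pdf :: "'a measure \<Rightarrow> ('a \<Rightarrow> real) \<Rightarrow> real \<Rightarrow> ennreal" where
  "pdf M Z = RN_deriv lborel (distr M borel Z)"

lemma pdf_unique:
  assumes "distributed M lborel Z f"
  shows "AE x in lborel. pdf M Z x = f x"
proof -
  have f: "f \<in> borel_measurable lborel" and d: "distr M lborel Z = density lborel f"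
    using assms unfolding distributed_def by auto
  have "distr M borel Z = distr M lborel Z" by (rule distr_cong) simp_all
  with d have "density lborel f = distr M borel Z" by simp
  from sigma_finite_measure.RN_deriv_unique[OF sigma_finite_lborel f this] show ?thesis
    unfolding pdf_def by eventually_elim simp
qed

text \<open>The (closed, topological) support of the distribution of \<open>Z\<close>.\<close>

definition rv_support :: "'a measure \<Rightarrow> ('a \<Rightarrow> real) \<Rightarrow> real set" where
  "rv_support M Z = {x. \<forall>U. open U \<longrightarrow> x \<in> U \<longrightarrow> measure (distr M borel Z) U > 0}"

text \<open>The integrands are non-negative, so the integrals always exist in \<open>[0, \<infinity>]\<close>.
  Both notions are meant for \<open>0 \<le> t1 < t2\<close> and \<open>F t1 < F t2\<close>, where \<open>F\<close> is the cdf of \<open>Z\<close>;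
  in particular \<open>ennreal x\<close> then does not truncate.\<close>

definition interval_extropy :: "'a measure \<Rightarrow> ('a \<Rightarrow> real) \<Rightarrow> real \<Rightarrow> real \<Rightarrow> ereal" where
  "interval_extropy M Z t1 t2 =
     - (ereal (1 / (2 * (cdf (distr M borel Z) t2 - cdf (distr M borel Z) t1)\<^sup>2)) *
        enn2ereal (\<integral>\<^sup>+ x \<in> {t1..t2}. (pdf M Z x)\<^sup>2 \<partial>lborel))"

definition weighted_interval_extropy :: "'a measure \<Rightarrow> ('a \<Rightarrow> real) \<Rightarrow> real \<Rightarrow> real \<Rightarrow> ereal" where
  "weighted_interval_extropy M Z t1 t2 =
     - (ereal (1 / (2 * (cdf (distr M borel Z) t2 - cdf (distr M borel Z) t1)\<^sup>2)) *
        enn2ereal (\<integral>\<^sup>+ x \<in> {t1..t2}. (ennreal x * (pdf M Z x)\<^sup>2) \<partial>lborel))"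

end

theory Submission imports Defs begin

text \<open>With \<open>f\<close> a density of \<open>X\<close>, the affine variable
  \<open>Y\<close> has density \<open>f ((y - b) / a) / a\<close>. Substituting
  \<open>y = a * x + b\<close> turns \<open>y\<close> times its square, together with the Jacobian
  \<open>a\<close>, into \<open>a * (a * x + b) / a^2 = x + b / a\<close> times \<open>f x\<close>
  squared, over the rescaled interval; the two summands give the weighted and the plain extropy of
  \<open>X\<close>. The normalising factors agree by \<open>cdf_affine_pos\<close>.
  \<open>distributed_pdf\<close> makes the density of \<open>Y\<close> available, and
  \<open>rv_support_lower_bound\<close> keeps the interval inside the region where the weight is
  nonnegative. The integrals may be infinite, so they are split in \<open>ennreal\<close> and only
  then carried over to \<open>ereal\<close>.\<close>

lemma distributed_pdf:
  assumes "abs_continuous_rv M Z"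
  shows "distributed M lborel Z (pdf M Z)"
proof -
  have [measurable]: "Z \<in> borel_measurable M"
    and ac: "absolutely_continuous lborel (distr M borel Z)"
    using assms by (auto simp: abs_continuous_rv_def)
  have "density lborel (pdf M Z) = distr M borel Z"
    unfolding pdf_def using ac by (intro sigma_finite_measure.density_RN_deriv) (auto intro: sigma_finite_lborel)
  moreover have "distr M borel Z = distr M lborel Z" by (rule distr_cong) simp_all
  ultimately show ?thesis
    unfolding distributed_def by (auto simp: pdf_def)
qed

text \<open>Otherwise the open half-line below \<open>c\<close> would be a neighbourhood of
  \<open>t\<close> of probability zero.\<close>

lemma rv_support_lower_bound:
  assumes "Y \<in> borel_measurable M" "AE \<omega> in M. c \<le> Y \<omega>" "t \<in> rv_support M Y"
  shows "c \<le> t"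
proof (rule ccontr)
  assume "\<not> c \<le> t"
  then have "measure (distr M borel Y) {..<c} > 0"
    using assms(3) unfolding rv_support_def by auto
  moreover have "emeasure M (Y -` {..<c} \<inter> space M) = 0"
    using assms(1,2) by (subst AE_iff_measurable[symmetric, where P="\<lambda>\<omega>. c \<le> Y \<omega>"]) auto
  then have "measure (distr M borel Y) {..<c} = 0"
    using assms(1) by (simp add: measure_def emeasure_distr)
  ultimately show False by simp
qed

lemma cdf_affine_pos:
  assumes "X \<in> borel_measurable M" "a > 0"
  shows "cdf (distr M borel (\<lambda>\<omega>. a * X \<omega> + b)) t = cdf (distr M borel X) ((t - b) / a)"
  using assms unfolding cdf_def
  by (subst (1 2) measure_distr) (auto intro!: arg_cong[where f="measure M"] simp: field_simps)

theorem proposition6: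
  fixes M :: "'a measure" and X Y :: "'a \<Rightarrow> real" and a b t1 t2 :: real
  assumes "prob_space M"
    and "abs_continuous_rv M X"
    and "AE \<omega> in M. 0 \<le> X \<omega>"
    and "a > 0" and "b \<ge> 0"
    and "Y = (\<lambda>\<omega>. a * X \<omega> + b)"
    and "t1 \<in> rv_support M Y" and "t2 \<in> rv_support M Y" and "t1 < t2"
    and "cdf (distr M borel Y) t1 < cdf (distr M borel Y) t2"
  shows "weighted_interval_extropy M Y t1 t2 =
    weighted_interval_extropy M X ((t1 - b) / a) ((t2 - b) / a)
    + ereal (b / a) * interval_extropy M X ((t1 - b) / a) ((t2 - b) / a)"
proof -
  note a = \<open>a > 0\<close> and b = \<open>b \<ge> 0\<close> and Y = \<open>Y = _\<close>
  define f where "f = pdf M X"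
  define s1 where "s1 = (t1 - b) / a"
  define s2 where "s2 = (t2 - b) / a"
  \<comment> \<open>Written with the cdf of \<open>Y\<close>; by \<open>cdf_affine_pos\<close> it is
    also the factor for \<open>X\<close> on \<open>s1\<close>, \<open>s2\<close>.\<close>
  define C where "C = 1 / (2 * (cdf (distr M borel Y) t2 - cdf (distr M borel Y) t1)\<^sup>2)"
  define I where "I = (\<integral>\<^sup>+ x \<in> {s1..s2}. (ennreal x * (f x)\<^sup>2) \<partial>lborel)"
  define J where "J = (\<integral>\<^sup>+ x \<in> {s1..s2}. (f x)\<^sup>2 \<partial>lborel)"
  have X[measurable]: "X \<in> borel_measurable M"
    using assms(2) by (simp add: abs_continuous_rv_def)
  have f[measurable]: "f \<in> borel_measurable borel" by (simp add: f_def pdf_def)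
  \<comment> \<open>The lower bound on the support is what keeps \<open>ennreal\<close> from truncating the weight.\<close>
  have "AE \<omega> in M. b \<le> Y \<omega>"
    using assms(3) by eventually_elim (use a Y in simp)
  then have "b \<le> t1"
    using assms(7) by (intro rv_support_lower_bound[of Y M]) (simp_all add: Y)
  then have s1: "0 \<le> s1" using a by (simp add: s1_def)
  \<comment> \<open>The affine change of variables yields one density of \<open>Y\<close>;
    \<open>pdf_unique\<close> identifies it almost everywhere with the Radon-Nikodym version, which
    is enough under the integral.\<close>
  have pdfY: "AE y in lborel. pdf M Y y = ennreal (1 / a) * f ((y - b) / a)"
    using pdf_unique[OF prob_space.distributed_affine[OF assms(1) distributed_pdf[OF assms(2)], of a b]] a
    by (simp add: Y f_def divide_ennreal_def inverse_ennreal mult.commute add.commute inverse_eq_divide)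
  \<comment> \<open>The left side has the shape produced by \<open>nn_integral_real_affine\<close>,
    Jacobian included. Splitting \<open>ennreal (x + b / a)\<close> into a sum needs both terms
    nonnegative, hence \<open>0 \<le> s1\<close>.\<close>
  have integrand: "ennreal \<bar>a\<bar> * (ennreal (b + a * x) * (ennreal (1 / a) * f (((b + a * x) - b) / a))\<^sup>2
        * indicator {t1..t2} (b + a * x))
      = ennreal x * (f x)\<^sup>2 * indicator {s1..s2} x
        + ennreal (b / a) * ((f x)\<^sup>2 * indicator {s1..s2} x)" for x
  proof (cases "x \<in> {s1..s2}")
    case True
    then have x: "0 \<le> x" using s1 by simp
    have ind: "b + a * x \<in> {t1..t2}"
      using True a by (auto simp: s1_def s2_def field_simps)
    have "ennreal \<bar>a\<bar> * (ennreal (b + a * x) * (ennreal (1 / a) * f (((b + a * x) - b) / a))\<^sup>2)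
        = ennreal (a * (b + a * x) * (1 / a)\<^sup>2) * (f x)\<^sup>2"
      using a b x by (simp add: ennreal_mult power_mult_distrib ennreal_power mult.assoc)
    also have "a * (b + a * x) * (1 / a)\<^sup>2 = x + b / a"
      using a by (simp add: field_simps power2_eq_square)
    finally show ?thesis
      using True ind a b x by (simp add: distrib_right)
  next
    case False
    then have "b + a * x \<notin> {t1..t2}"
      using a by (auto simp: s1_def s2_def field_simps)
    with False show ?thesis by simp
  qed
  have "(\<integral>\<^sup>+ y \<in> {t1..t2}. (ennreal y * (pdf M Y y)\<^sup>2) \<partial>lborel)
      = (\<integral>\<^sup>+ y. ennreal y * (ennreal (1 / a) * f ((y - b) / a))\<^sup>2 * indicator {t1..t2} y \<partial>lborel)"
    by (intro nn_integral_cong_AE) (use pdfY in \<open>eventually_elim, simp\<close>)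
  also have "\<dots> = ennreal \<bar>a\<bar> * (\<integral>\<^sup>+ x. ennreal (b + a * x)
      * (ennreal (1 / a) * f (((b + a * x) - b) / a))\<^sup>2 * indicator {t1..t2} (b + a * x) \<partial>lborel)"
    using a by (intro nn_integral_real_affine) auto
  also have "\<dots> = (\<integral>\<^sup>+ x. ennreal x * (f x)\<^sup>2 * indicator {s1..s2} x
      + ennreal (b / a) * ((f x)\<^sup>2 * indicator {s1..s2} x) \<partial>lborel)"
    unfolding integrand[symmetric] by (intro nn_integral_cmult[symmetric]) measurable
  also have "\<dots> = I + ennreal (b / a) * J"
    unfolding I_def J_def by (simp add: nn_integral_add nn_integral_cmult)
  finally have main: "(\<integral>\<^sup>+ y \<in> {t1..t2}. (ennreal y * (pdf M Y y)\<^sup>2) \<partial>lborel) = I + ennreal (b / a) * J" .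
  have "C \<ge> 0" by (simp add: C_def)
  \<comment> \<open>A finite nonnegative factor distributes over \<open>ereal\<close> sums even when
    the integrals are infinite.\<close>
  have "ereal C * enn2ereal (I + ennreal (b / a) * J)
      = ereal C * enn2ereal I + ereal (b / a) * (ereal C * enn2ereal J)"
    using a b \<open>C \<ge> 0\<close>
    by (simp add: plus_ennreal.rep_eq times_ennreal.rep_eq ereal_pos_distrib enn2ereal_ennreal ac_simps)
  \<comment> \<open>Negation is not additive on opposite infinities in \<open>ereal\<close>; the
    sign conditions exclude that case.\<close>
  moreover have "- (x + c * y) = - x + c * - y" if "0 \<le> x" "0 \<le> c * y" for x c y :: ereal
    using that by (cases "c * y"; cases x) auto
  ultimately have "- (ereal C * enn2ereal (I + ennreal (b / a) * J))
      = - (ereal C * enn2ereal I) + ereal (b / a) * - (ereal C * enn2ereal J)"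
    using a b \<open>C \<ge> 0\<close> by simp
  then show ?thesis
    unfolding weighted_interval_extropy_def interval_extropy_def main
    using a by (simp add: Y C_def I_def J_def s1_def s2_def f_def cdf_affine_pos)
qed

end
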